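(* Let $S$ be a finite set of integers and let $\omega \in S^{\mathbb{N}}$ have bounded additive complexity. Then $\mathrm{slope}(\omega) \in \mathbb{Q}$ if and only if $\omega = AB_1B_2B_3\cdots$ for some finite (possibly empty) word $A$ and some sequence $\{B_i\}_{i\in\mathbb{N}}$ of nonempty factors of $\omega$ such that $\mathrm{slope}(B_1) = \mathrm{slope}(B_i)$ for all $i \in \mathbb{N}$. Moreover, for such a factorization, $\mathrm{slope}(B_1) = \mathrm{slope}(\omega)$.
   Context: $\mathbb{N}$ denotes the positive integers. Alphabets are finite sets of integers. An infinite word over $S$ is a sequence $\omega = x_1x_2x_3\cdots$ with $x_i \in S$; $S^{\mathbb{N}}$ is the set of these. For $m \le n$, $\omega[m,n] = x_m x_{m+1}\cdots x_n$; the nonempty factors of $\omega$ are the finite words of this form. $|B|$ is the length of a finite word $B$, and if $B = y_1\cdots y_n$ then $\sum B = y_1+\cdots+y_n$. $\omega$ has bounded additive complexity if there is $M\in\mathbb{N}$ such that for every $n\in\mathbb{N}$ the set $\{\sum B : B \text{ a factor of } \omega,\ |B|=n\}$ has at most $M$ elements. For a nonempty finite word $B$, $\mathrm{slope}(B) = \frac{1}{|B|}\sum B$; for an infinite word, $\mathrm{slope}(\omega) = \lim_{n\to\infty} \mathrm{slope}(\omega[1,n])$, if this limit exists (it exists whenever $\omega$ has bounded additive complexity). *)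

theory Defs
  imports "HOL-Analysis.Analysis" "HOL-Library.Stream"
begin

text \<open>
  Infinite words are streams, so \<^term>\<open>streams S\<close> is the set of infinite words over \<^term>\<open>S\<close>;
  finite words are lists. Positions are counted from \<open>0\<close>: the letter \<open>x\<^sub>i\<close> of \<open>x\<^sub>1x\<^sub>2x\<^sub>3\<dots>\<close> is
  \<open>\<omega> !! (i - 1)\<close>, and \<open>segment \<omega> m n\<close> (both ends included) is \<open>\<omega>[m + 1, n + 1]\<close>.
\<close>

definition segment :: "'a stream \<Rightarrow> nat \<Rightarrow> nat \<Rightarrow> 'a list"
  where "segment \<omega> m n = map (snth \<omega>) [m..<Suc n]"

text \<open>Nonempty factors only.\<close>

definition factors :: "'a stream \<Rightarrow> 'a list set"
  where "factors \<omega> = {segment \<omega> m n | m n. m \<le> n}"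

definition bounded_additive_complexity :: "int stream \<Rightarrow> bool"
  where "bounded_additive_complexity \<omega> \<longleftrightarrow>
    (\<exists>M>0. \<forall>n>0. finite (sum_list ` {B \<in> factors \<omega>. length B = n}) \<and>
                 card (sum_list ` {B \<in> factors \<omega>. length B = n}) \<le> M)"

definition word_slope :: "int list \<Rightarrow> real"
  where "word_slope B = real_of_int (sum_list B) / real (length B)"

text \<open>
  The value is meaningful only if the limit exists; see \<open>slope_convergent\<close> below.
\<close>

definition slope :: "int stream \<Rightarrow> real"
  where "slope \<omega> = lim (\<lambda>n. word_slope (stake n \<omega>))"

text \<open>
  The factorization \<open>\<omega> = A B\<^sub>1 B\<^sub>2 B\<^sub>3 \<dots>\<close>, where \<open>B\<^sub>i\<close> is \<open>B !! (i - 1)\<close>. Members of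
  \<^term>\<open>factors \<omega>\<close> are nonempty, so \<^term>\<open>flat B\<close> is the infinite concatenation.
\<close>

definition equal_slope_factorization :: "int stream \<Rightarrow> int list \<Rightarrow> int list stream \<Rightarrow> bool"
  where "equal_slope_factorization \<omega> A B \<longleftrightarrow>
    \<omega> = A @- flat B \<and>
    (\<forall>i. B !! i \<in> factors \<omega>) \<and>
    (\<forall>i. word_slope (B !! 0) = word_slope (B !! i))"


text \<open>Existence of the slope under bounded additive complexity.\<close>

lemma small_steps_bound:
  fixes f :: "nat \<Rightarrow> int"
  assumes step: "\<And>m. \<bar>f (Suc m) - f m\<bar> \<le> D"
  shows "i \<le> m \<Longrightarrow> j \<le> m \<Longrightarrow> \<bar>f i - f j\<bar> \<le> D * (int (card (f ` {..m})) - 1)"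
proof (induction m arbitrary: i j)
  case (Suc m)
  have img: "f ` {..Suc m} = insert (f (Suc m)) (f ` {..m})"
    by (simp add: atMost_Suc)
  show ?case
  proof (cases "f (Suc m) \<in> f ` {..m}")
    case True
    then have eq: "f ` {..Suc m} = f ` {..m}" using img by auto
    have "\<exists>k\<le>m. f i = f k" if "i \<le> Suc m" for i
      using that True by (cases "i = Suc m") (auto simp: le_Suc_eq)
    then obtain k l where "k \<le> m" "l \<le> m" "f i = f k" "f j = f l"
      using Suc.prems by meson
    then show ?thesis using Suc.IH[of k l] eq by simp
  next
    case False
    then have c: "int (card (f ` {..Suc m})) = int (card (f ` {..m})) + 1"
      unfolding img by simp
    have D: "D \<ge> 0" using step[of 0] by linarith
    have *: "\<bar>f (Suc m) - f k\<bar> \<le> D * (int (card (f ` {..Suc m})) - 1)" if "k \<le> m" for k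
      using Suc.IH[of m k] that step[of m] unfolding c by (simp add: algebra_simps)
    have "0 \<le> D * (int (card (f ` {..Suc m})) - 1)"
      using D unfolding c by simp
    moreover have "\<bar>f i - f j\<bar> \<le> D * (int (card (f ` {..Suc m})) - 1)" if "i \<le> m" "j \<le> m"
      using Suc.IH[OF that] D unfolding c by (simp add: algebra_simps)
    ultimately show ?thesis
      using Suc.prems *[of i] *[of j] by (auto simp: le_Suc_eq abs_minus_commute)
  qed
qed simp

lemma stake_sdrop_in_factors:
  assumes "n > 0"
  shows "stake n (sdrop m \<omega>) \<in> factors \<omega>"
proof -
  have "stake n (sdrop m \<omega>) = segment \<omega> m (m + n - 1)"
    using assms by (intro nth_equalityI) (auto simp: segment_def sdrop_snth add.commute simp del: upt_Suc)
  then show ?thesis using assms unfolding factors_def by force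
qed

lemma slope_convergent:
  assumes fin: "finite S" and om: "\<omega> \<in> streams S" and bac: "bounded_additive_complexity \<omega>"
  shows "convergent (\<lambda>n. word_slope (stake n \<omega>))"
proof -
  define F where "F n m = sum_list (stake n (sdrop m \<omega>))" for n m
  have "bdd_above (abs ` S)" using fin by simp
  then obtain K where K: "\<And>x. x \<in> S \<Longrightarrow> \<bar>x\<bar> \<le> K"
    unfolding bdd_above_def by blast
  have let_S: "\<omega> !! i \<in> S" for i using om by (metis snth_in)
  obtain M where M: "\<And>n. n > 0 \<Longrightarrow> finite (sum_list ` {B \<in> factors \<omega>. length B = n}) \<and>
                 card (sum_list ` {B \<in> factors \<omega>. length B = n}) \<le> M"
    using bac unfolding bounded_additive_complexity_def by blast
  have F_add: "F (a + b) m = F a m + F b (m + a)" for a b m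
    by (simp add: F_def stake_add[symmetric] sdrop_add)
  have F1: "F 1 m = \<omega> !! m" for m by (simp add: F_def)
  have step: "\<bar>F n (Suc m) - F n m\<bar> \<le> 2 * K" for n m
  proof -
    have "F 1 m + F n (Suc m) = F n m + F 1 (m + n)"
      using F_add[of 1 n m] F_add[of n 1 m] by simp
    then show ?thesis
      using K[OF let_S[of m]] K[OF let_S[of "m + n"]] unfolding F1 by linarith
  qed
  define C where "C = 2 * K * int M"
  have K0: "K \<ge> 0" using K[OF let_S[of 0]] by linarith
  have dev: "\<bar>F n m - F n 0\<bar> \<le> C" if "n > 0" for n m
  proof -
    have "F n ` {..m} \<subseteq> sum_list ` {B \<in> factors \<omega>. length B = n}"
      using stake_sdrop_in_factors[OF that] by (auto simp: F_def intro!: imageI)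
    then have "card (F n ` {..m}) \<le> M"
      using M[OF that] by (meson card_mono le_trans)
    then have "2 * K * (int (card (F n ` {..m})) - 1) \<le> C"
      unfolding C_def using K0 by (intro mult_left_mono) auto
    then show ?thesis
      using small_steps_bound[of "F n" "2 * K" m m 0, OF step] by simp
  qed
  have mult: "\<bar>F (k * n) 0 - int k * F n 0\<bar> \<le> int k * C" if "n > 0" for k n
  proof (induction k)
    case (Suc k)
    have "F (Suc k * n) 0 = F (k * n) 0 + F n (k * n)"
      using F_add[of "k * n" n 0] by (simp add: add.commute)
    then show ?case using Suc dev[OF that, of "k * n"] by (simp add: algebra_simps)
  qed (simp add: F_def)
  define s where "s n = word_slope (stake n \<omega>)" for n
  have s: "s n = F n 0 / n" for n by (simp add: s_def word_slope_def F_def)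
  have half: "\<bar>s (k * n) - s n\<bar> \<le> C / n" if "n > 0" "k > 0" for k n
  proof -
    have "\<bar>real_of_int (F (k * n) 0) - k * real_of_int (F n 0)\<bar> \<le> real k * C"
    proof -
      have "real_of_int \<bar>F (k * n) 0 - int k * F n 0\<bar> \<le> real_of_int (int k * C)"
        using mult[OF that(1), of k] by (simp only: of_int_le_iff)
      then show ?thesis by simp
    qed
    moreover have "s (k * n) - s n = (F (k * n) 0 - k * real_of_int (F n 0)) / real (k * n)"
      using that by (simp add: s field_simps)
    ultimately have "\<bar>s (k * n) - s n\<bar> \<le> (real k * C) / real (k * n)"
      by (simp only: abs_divide abs_of_nat divide_right_mono of_nat_0_le_iff)
    then show ?thesis using that by simp
  qed
  have C0: "C \<ge> 0" using K0 by (simp add: C_def)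
  have "Cauchy s"
  proof (rule metric_CauchyI)
    fix e :: real assume "e > 0"
    obtain N where N: "real N > 2 * C / e" using reals_Archimedean2 by blast
    have small: "C / n < e / 2" if "n \<ge> Suc N" for n :: nat
    proof -
      have "real n > 2 * C / e" using N that by linarith
      then show ?thesis using that \<open>e > 0\<close> by (simp add: field_simps)
    qed
    show "\<exists>N. \<forall>m\<ge>N. \<forall>n\<ge>N. dist (s m) (s n) < e"
    proof (intro exI allI impI)
      fix m n assume mn: "m \<ge> Suc N" "n \<ge> Suc N"
      then have "\<bar>s (n * m) - s m\<bar> \<le> C / m" "\<bar>s (n * m) - s n\<bar> \<le> C / n"
        using half[of m n] half[of n m] by (simp_all add: mult.commute)
      then show "dist (s m) (s n) < e"
        using small[OF mn(1)] small[OF mn(2)] unfolding dist_real_def by linarith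
    qed
  qed
  then show ?thesis unfolding s_def by (rule Cauchy_convergent)
qed

end

theory Submission
  imports Defs
begin

text \<open>
  Equal-length factors have sums differing by at most a constant \<open>C\<close>. Cutting a long prefix
  into blocks of length \<open>n\<close> and letting the number of blocks grow, the sum of the prefix of
  length \<open>n\<close> differs from \<open>n s\<close>, with \<open>s\<close> the slope, by at most \<open>C\<close>. If \<open>s\<close> is rational,
  these differences lie in a discrete set, so one of them occurs at infinitely many \<open>n\<close>; between
  any two such positions the factor has slope exactly \<open>s\<close>. Conversely, a factorization with
  common slope \<open>r\<close> forces the prefix slopes to tend to \<open>r\<close> along the cutting points.
\<close>

section \<open>Factors and the deviation of their sums\<close>

lemma factors_nonempty: "B \<in> factors \<omega> \<Longrightarrow> B \<noteq> []"
  by (auto simp: factors_def segment_def simp del: upt_Suc)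

lemma sum_stake_add:
  fixes \<omega> :: "int stream"
  shows "sum_list (stake (a + b) \<omega>) = sum_list (stake a \<omega>) + sum_list (stake b (sdrop a \<omega>))"
  by (metis stake_add sum_list_append)

text \<open>Shifting a window by one position changes its sum by at most \<open>2 * K\<close>, and
  windows of a given length have at most \<open>M\<close> different sums. A sequence with small
  steps and few values has a small spread, by \<open>small_steps_bound\<close>; neither
  \<open>K\<close> nor \<open>M\<close> depends on the length.\<close>

lemma block_sums_balanced:
  fixes \<omega> :: "int stream"
  assumes fin: "finite S" and om: "\<omega> \<in> streams S" and bac: "bounded_additive_complexity \<omega>"
  obtains C where "\<And>n m. \<bar>sum_list (stake n (sdrop m \<omega>)) - sum_list (stake n \<omega>)\<bar> \<le> C"
proof -
  obtain K where K: "\<And>x. x \<in> S \<Longrightarrow> \<bar>x\<bar> \<le> K"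
    using bdd_above_finite[of "abs ` S"] fin unfolding bdd_above_def by blast
  have letter: "\<bar>\<omega> !! i\<bar> \<le> K" for i using om by (intro K) (metis snth_in)
  have K0: "K \<ge> 0" using letter[of 0] by linarith
  obtain M where M: "\<And>n. n > 0 \<Longrightarrow> finite (sum_list ` {B \<in> factors \<omega>. length B = n}) \<and>
                 card (sum_list ` {B \<in> factors \<omega>. length B = n}) \<le> M"
    using bac unfolding bounded_additive_complexity_def by blast
  define F where "F n m = sum_list (stake n (sdrop m \<omega>))" for n m
  have step: "\<bar>F n (Suc m) - F n m\<bar> \<le> 2 * K" for n m
  proof -
    \<comment> \<open>Both sides sum the \<open>n + 1\<close> letters from position \<open>m\<close>
      on, splitting off the first or the last of them.\<close>
    have "\<omega> !! m + F n (Suc m) = F n m + \<omega> !! (m + n)"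
      using sum_stake_add[of 1 n "sdrop m \<omega>"] sum_stake_add[of n 1 "sdrop m \<omega>"]
      by (simp add: F_def sdrop_snth)
    then show ?thesis using letter[of m] letter[of "m + n"] by linarith
  qed
  have "\<bar>F n m - F n 0\<bar> \<le> 2 * K * int M" for n m
  proof (cases "n = 0")
    case False
    have "F n ` {..m} \<subseteq> sum_list ` {B \<in> factors \<omega>. length B = n}"
      using False by (auto simp: F_def intro!: imageI stake_sdrop_in_factors)
    then have "card (F n ` {..m}) \<le> M"
      using M[of n] False by (meson card_mono le_trans not_gr_zero)
    then have "2 * K * (int (card (F n ` {..m})) - 1) \<le> 2 * K * int M"
      using K0 by (intro mult_left_mono) auto
    then show ?thesis using small_steps_bound[of "F n" "2 * K" m m 0, OF step] by simp
  qed (use K0 in \<open>simp add: F_def\<close>)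
  then have "\<bar>sum_list (stake n (sdrop m \<omega>)) - sum_list (stake n \<omega>)\<bar> \<le> 2 * K * int M" for n m
    by (simp add: F_def)
  then show thesis by (rule that)
qed

lemma slope_LIMSEQ:
  assumes "finite S" "\<omega> \<in> streams S" "bounded_additive_complexity \<omega>"
  shows "(\<lambda>n. word_slope (stake n \<omega>)) \<longlonglongrightarrow> slope \<omega>"
  using slope_convergent[OF assms] unfolding slope_def by (simp add: convergent_LIMSEQ_iff)

text \<open>Convergence of the prefix slopes alone would only give an error that is small relative
  to \<open>n\<close>; the bound uniform in \<open>n\<close> comes from balanced block sums.\<close>

lemma prefix_sums_near_slope:
  fixes \<omega> :: "int stream"
  assumes "finite S" "\<omega> \<in> streams S" "bounded_additive_complexity \<omega>"
  obtains C where "\<And>n. \<bar>real_of_int (sum_list (stake n \<omega>)) - n * slope \<omega>\<bar> \<le> C"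
proof -
  obtain C where C: "\<And>n m. \<bar>sum_list (stake n (sdrop m \<omega>)) - sum_list (stake n \<omega>)\<bar> \<le> C"
    using block_sums_balanced[OF assms] by blast
  define P where "P n = sum_list (stake n \<omega>)" for n
  have mult: "\<bar>P (k * n) - int k * P n\<bar> \<le> int k * C" for k n
  proof (induction k)
    case (Suc k)
    have "P (Suc k * n) = P (k * n) + sum_list (stake n (sdrop (k * n) \<omega>))"
      using sum_stake_add[of "k * n" n \<omega>] by (simp add: P_def add.commute)
    then show ?case using Suc C[of n "k * n"] by (simp add: P_def algebra_simps)
  qed (simp add: P_def)
  have "\<bar>real_of_int (P n) - n * slope \<omega>\<bar> \<le> real_of_int C" for n
  proof (cases "n = 0")
    case True
    then show ?thesis using C[of 0 0] by (simp add: P_def)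
  next
    case False
    \<comment> \<open>\<open>Suc k\<close> avoids the empty prefix, whose \<open>word_slope\<close>
      is the default value 0 of division by zero and need not obey the bound below.\<close>
    have "strict_mono (\<lambda>k. Suc k * n)"
      using False by (intro strict_monoI) simp
    then have "(\<lambda>k. word_slope (stake (Suc k * n) \<omega>)) \<longlonglongrightarrow> slope \<omega>"
      using LIMSEQ_subseq_LIMSEQ[OF slope_LIMSEQ[OF assms]] by (simp add: o_def)
    then have lim: "(\<lambda>k. \<bar>real_of_int (P n) - n * word_slope (stake (Suc k * n) \<omega>)\<bar>)
        \<longlonglongrightarrow> \<bar>real_of_int (P n) - n * slope \<omega>\<bar>"
      by (intro tendsto_intros)
    have "\<bar>real_of_int (P n) - n * word_slope (stake (Suc k * n) \<omega>)\<bar> \<le> C" for k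
    proof -
      have "real_of_int \<bar>P (Suc k * n) - int (Suc k) * P n\<bar> \<le> real_of_int (int (Suc k) * C)"
        using mult by (simp only: of_int_le_iff)
      then have "\<bar>real_of_int (P (Suc k * n)) - Suc k * real_of_int (P n)\<bar> \<le> Suc k * real_of_int C"
        by simp
      \<comment> \<open>Multiplying by the number of blocks clears the denominator of the long
        prefix's slope.\<close>
      moreover have "Suc k * (real_of_int (P n) - n * word_slope (stake (Suc k * n) \<omega>))
          = - (real_of_int (P (Suc k * n)) - Suc k * real_of_int (P n))"
      proof -
        have "real (Suc k * n) * word_slope (stake (Suc k * n) \<omega>) = P (Suc k * n)"
          using False by (simp add: word_slope_def P_def del: mult_Suc)
        then show ?thesis
          unfolding of_nat_mult by (simp only: right_diff_distrib minus_diff_eq mult.assoc)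
      qed
      ultimately have "real (Suc k) * \<bar>real_of_int (P n) - n * word_slope (stake (Suc k * n) \<omega>)\<bar>
          \<le> Suc k * real_of_int C"
        by (metis abs_minus_cancel abs_mult abs_of_nat)
      then show ?thesis by (rule mult_left_le_imp_le) simp
    qed
    then show ?thesis using lim by (intro LIMSEQ_le_const2) auto
  qed
  then show thesis unfolding P_def by (rule that)
qed

section \<open>Infinite concatenations of words\<close>

lemma flat_eq_concat_stake_shift:
  assumes "\<And>i. B !! i \<noteq> []"
  shows "flat B = concat (stake k B) @- flat (sdrop k B)"
proof (induction k)
  case (Suc k)
  \<comment> \<open>\<open>flat\<close> unfolds by a whole word only if that word is
    nonempty.\<close>
  have "flat (sdrop k B) = (B !! k) @- flat (sdrop (Suc k) B)"
    using flat_unfold[of "sdrop k B"] assms[of k] by (simp del: sdrop.simps)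
  then show ?case
    using Suc by (simp add: stake_Suc shift_append del: stake.simps sdrop.simps)
qed simp

text \<open>Each word contributes at least one letter. Hence the first \<open>Suc n\<close> words
  reach position \<open>n\<close>, and cutting points tend to infinity.\<close>

lemma length_concat_stake_ge:
  assumes "\<And>i. B !! i \<noteq> []"
  shows "k \<le> length (concat (stake k B))"
proof (induction k)
  case (Suc k)
  have "length (concat (stake (Suc k) B)) = length (concat (stake k B)) + length (B !! k)"
    by (simp add: stake_Suc del: stake.simps)
  moreover have "length (B !! k) > 0" using assms by simp
  ultimately show ?case using Suc by linarith
qed simp

text \<open>The first \<open>k\<close> pieces telescope to the stretch from \<open>e 0\<close> to
  \<open>e k\<close>, so the two streams agree letter by letter.\<close>

lemma sdrop_eq_flat_between_cuts:
  assumes e: "strict_mono e"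
  shows "sdrop (e 0) \<omega> = flat (smap (\<lambda>i. stake (e (Suc i) - e i) (sdrop (e i) \<omega>)) nats)"
    (is "_ = flat ?B")
proof -
  have lt: "e i < e (Suc i)" for i using e by (simp add: strict_mono_Suc_iff)
  have B: "?B !! i \<noteq> []" for i using lt[of i] by (simp flip: length_0_conv)
  have concat: "concat (stake k ?B) = stake (e k - e 0) (sdrop (e 0) \<omega>)" for k
  proof (induction k)
    case (Suc k)
    have "e 0 \<le> e k" using e by (simp add: strict_mono_less_eq)
    then have "stake (e (Suc k) - e 0) (sdrop (e 0) \<omega>)
        = stake (e k - e 0) (sdrop (e 0) \<omega>) @ stake (e (Suc k) - e k) (sdrop (e k) \<omega>)"
      using lt[of k] stake_add[of "e k - e 0" "sdrop (e 0) \<omega>" "e (Suc k) - e k"]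
      by (simp add: sdrop_add)
    then show ?case using Suc by (simp add: stake_Suc del: stake.simps)
  qed simp
  have "sdrop (e 0) \<omega> !! n = flat ?B !! n" for n
  proof -
    let ?c = "concat (stake (Suc n) ?B)"
    have n: "n < length ?c" using length_concat_stake_ge[OF B, of "Suc n"] by linarith
    then have "flat ?B !! n = ?c ! n"
      by (subst flat_eq_concat_stake_shift[OF B, of "Suc n"]) (rule shift_snth_less)
    also have "\<dots> = sdrop (e 0) \<omega> !! n"
      using n unfolding concat by (simp add: stake_nth)
    finally show ?thesis by simp
  qed
  \<comment> \<open>Applied to \<open>id\<close>, \<open>smap_alt\<close> serves as extensionality
    for streams.\<close>
  then have "smap id (sdrop (e 0) \<omega>) = flat ?B" by (subst smap_alt) simp
  then show ?thesis by (simp add: stream.map_id)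
qed

section \<open>Rational slopes and equal-slope factorizations\<close>

lemma rational_slope_imp_factorization:
  assumes "finite S" "\<omega> \<in> streams S" "bounded_additive_complexity \<omega>" and rat: "slope \<omega> \<in> \<rat>"
  shows "\<exists>A B. equal_slope_factorization \<omega> A B"
proof -
  obtain C where C: "\<And>n. \<bar>real_of_int (sum_list (stake n \<omega>)) - n * slope \<omega>\<bar> \<le> C"
    using prefix_sums_near_slope[OF assms(1-3)] by blast
  obtain p q :: int where pq: "q > 0" "slope \<omega> = p / q"
    using rat by (elim Rats_cases') auto
  \<comment> \<open>The deviation of the prefix sum from \<open>n * slope \<omega>\<close>, scaled
    by the denominator \<open>q\<close> to make it an integer; bounded then means finitely many
    values.\<close>
  define d where "d n = q * sum_list (stake n \<omega>) - p * int n" for n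
  have d: "real_of_int (d n) = q * (sum_list (stake n \<omega>) - n * slope \<omega>)" for n
    using pq by (simp add: d_def algebra_simps)
  have "\<bar>real_of_int (d n)\<bar> \<le> q * C" for n
    unfolding d abs_mult using pq C[of n] by (simp add: mult_left_mono)
  then have "d n \<in> {- \<lceil>q * C\<rceil>..\<lceil>q * C\<rceil>}" for n
    by (simp add: abs_le_iff) (smt (verit) ceiling_le_iff le_of_int_ceiling of_int_le_iff of_int_minus)
  then have "finite (range d)"
    by (meson finite_atLeastAtMost_int finite_subset image_subsetI)
  then obtain m where "infinite {n. d n = d m}"
    using pigeonhole_infinite[of "UNIV :: nat set" d] by auto
  then obtain e :: "nat \<Rightarrow> nat" where e: "strict_mono e" "\<And>i. d (e i) = d m"
    using infinite_enumerate[of "{n. d n = d m}"] by auto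
  let ?b = "\<lambda>i. stake (e (Suc i) - e i) (sdrop (e i) \<omega>)"
  have lt: "e i < e (Suc i)" for i using e(1) by (simp add: strict_mono_Suc_iff)
  \<comment> \<open>\<open>d\<close> agrees at consecutive cuts, so subtracting its two values
    leaves exactly the slope equation for the piece between them.\<close>
  have "word_slope (?b i) = slope \<omega>" for i
  proof -
    have "sum_list (stake (e (Suc i)) \<omega>) = sum_list (stake (e i) \<omega>) + sum_list (?b i)"
      using sum_stake_add[of "e i" "e (Suc i) - e i" \<omega>] lt[of i] by simp
    then have "q * sum_list (?b i) = p * int (e (Suc i) - e i)"
      using e(2)[of i] e(2)[of "Suc i"] lt[of i] unfolding d_def
      by (simp add: algebra_simps of_nat_diff)
    then have "real_of_int (q * sum_list (?b i)) = real_of_int (p * int (e (Suc i) - e i))"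
      by simp
    then have "sum_list (?b i) = (p / q) * (e (Suc i) - e i)"
      using pq(1) by (simp add: field_simps)
    then show ?thesis
      using lt[of i] by (simp add: word_slope_def pq(2))
  qed
  then have "equal_slope_factorization \<omega> (stake (e 0) \<omega>) (smap ?b nats)"
    unfolding equal_slope_factorization_def
    using lt by (simp add: sdrop_eq_flat_between_cuts[OF e(1), symmetric] stake_sdrop
        stake_sdrop_in_factors)
  then show ?thesis by blast
qed

text \<open>Beyond \<open>A\<close>, complete words add exactly \<open>r\<close> per letter, so at
  cutting points the prefix slope is \<open>r\<close> plus a constant over the length. A subsequence
  suffices, since the prefix slopes are known to converge.\<close>

lemma factorization_slope:
  assumes "finite S" "\<omega> \<in> streams S" "bounded_additive_complexity \<omega>"
    and "equal_slope_factorization \<omega> A B"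
  shows "word_slope (B !! 0) = slope \<omega>"
proof -
  define r where "r = word_slope (B !! 0)"
  have \<omega>: "\<omega> = A @- flat B" and fac: "\<And>i. B !! i \<in> factors \<omega>"
    and eq: "\<And>i. word_slope (B !! i) = r"
    using assms(4) unfolding equal_slope_factorization_def r_def by auto
  have ne: "B !! i \<noteq> []" for i using fac factors_nonempty by blast
  define c where "c k = concat (stake k B)" for k
  have sum_c: "real_of_int (sum_list (c k)) = r * length (c k)" for k
  proof (induction k)
    case (Suc k)
    have "real_of_int (sum_list (B !! k)) = r * length (B !! k)"
      using eq[of k] ne[of k] by (simp add: word_slope_def field_simps)
    then show ?case using Suc by (simp add: c_def stake_Suc algebra_simps del: stake.simps)
  qed (simp add: c_def)
  define l where "l k = length A + length (c k)" for k
  have l: "k \<le> l k" for k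
    using length_concat_stake_ge[OF ne, of k] by (simp add: l_def c_def)
  have "filterlim l at_top sequentially"
    using l by (intro filterlim_at_top_mono[OF filterlim_ident]) auto
  then have lim: "(\<lambda>k. word_slope (stake (l k) \<omega>)) \<longlonglongrightarrow> slope \<omega>"
    and inv: "(\<lambda>k. inverse (real (l k))) \<longlonglongrightarrow> 0"
    using filterlim_compose[OF slope_LIMSEQ[OF assms(1-3)]]
      filterlim_compose[OF lim_inverse_n] by auto
  have prefix: "stake (l k) \<omega> = A @ c k" for k
  proof -
    have "\<omega> = (A @ c k) @- flat (sdrop k B)"
      using \<omega> flat_eq_concat_stake_shift[OF ne, of k] by (simp add: c_def shift_append)
    moreover have "l k = length (A @ c k)" by (simp add: l_def)
    ultimately show ?thesis by (metis stake_shift diff_self_eq_0 stake.simps(1) append_Nil2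
          take_all order_refl)
  qed
  \<comment> \<open>The numerator is the excess of \<open>A\<close> over slope \<open>r\<close>. The
    condition \<open>k > 0\<close> ensures a nonempty prefix even if \<open>A\<close> is
    empty.\<close>
  have slope_eq: "word_slope (stake (l k) \<omega>) = r + (sum_list A - r * length A) * inverse (real (l k))"
    if "k > 0" for k
  proof -
    have "l k > 0" using l[of k] that by linarith
    moreover have "length (A @ c k) = l k" by (simp add: l_def)
    moreover have "real_of_int (sum_list (A @ c k)) = sum_list A + r * (l k - length A)"
      using sum_c[of k] by (simp add: l_def)
    ultimately show ?thesis
      unfolding prefix word_slope_def by (simp only:) (simp add: field_simps)
  qed
  have "(\<lambda>k. r + (sum_list A - r * length A) * inverse (real (l k)))
      \<longlonglongrightarrow> r + (sum_list A - r * length A) * 0"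
    by (intro tendsto_intros inv)
  moreover have "\<forall>\<^sub>F k in sequentially. r + (sum_list A - r * length A) * inverse (real (l k))
      = word_slope (stake (l k) \<omega>)"
    using eventually_gt_at_top[of 0] by eventually_elim (simp add: slope_eq)
  ultimately have "(\<lambda>k. word_slope (stake (l k) \<omega>)) \<longlonglongrightarrow> r"
    using Lim_transform_eventually by fastforce
  then show ?thesis using lim LIMSEQ_unique unfolding r_def by blast
qed

theorem theorem2p5:
  fixes S :: "int set" and \<omega> :: "int stream"
  assumes "finite S"
    and "\<omega> \<in> streams S"
    and "bounded_additive_complexity \<omega>"
  shows "(slope \<omega> \<in> \<rat> \<longleftrightarrow> (\<exists>A B. equal_slope_factorization \<omega> A B)) \<and>
    (\<forall>A B. equal_slope_factorization \<omega> A B \<longrightarrow> word_slope (B !! 0) = slope \<omega>)"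
proof -
  \<comment> \<open>With \<open>factorization_slope\<close>, this also gives the converse direction:
    the slope equals that of a finite integer word.\<close>
  have "word_slope B \<in> \<rat>" for B by (simp add: word_slope_def)
  then show ?thesis
    using rational_slope_imp_factorization[OF assms] factorization_slope[OF assms] by metis
qed

end
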